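(* For each Tychonoff space $X$, $$wd(O_\omega(X))=wd(O_\beta(X))=wd(O_R(X))=wd(O_\tau(X))=wd(O(\beta X)).$$
   Context: For a compact Hausdorff space $K$, $C(K)$ is the space of continuous real-valued functions on $K$ with the pointwise order, and $c_K$ denotes the constant function with value $c\in\mathbb{R}$. $O(K)$ is the set of all functionals $\mu: C(K)\to\mathbb{R}$ (not necessarily linear) that are order-preserving ($\varphi\le\psi$ implies $\mu(\varphi)\le\mu(\psi)$), weakly additive ($\mu(\varphi+c_K)=\mu(\varphi)+c\,\mu(1_K)$ for all $\varphi\in C(K)$, $c\in\mathbb{R}$) and normed ($\mu(1_K)=1$). For a closed subset $A\subset K$, a functional $\mu\in O(K)$ is supported on $A$ if $\mu\in O(A)$, where $O(A)$ is identified with a subset of $O(K)$ via $\nu\mapsto(\varphi\mapsto\nu(\varphi|_A))$; the support $\operatorname{supp}\mu$ is the intersection of all closed $A\subset K$ on which $\mu$ is supported. For a Tychonoff space $X$, $\beta X$ is its Stone-Čech compactification, and: - $O_\tau(X)$ is the set of all $\mu\in O(\beta X)$ that are $\tau$-smooth, i.e. $\mu(\varphi_\alpha)\to 0$ for each net $\{\varphi_\alpha\}\subset C(\beta X)$ that decreases monotonically to zero on $X$ (for every $x\in X$: $\varphi_\alpha(x)\ge\varphi_{\beta}(x)$ whenever $\beta\succ\alpha$, and $\lim_\alpha\varphi_\alpha(x)=0$); - $O_R(X)$ is the set of all $\mu\in O(\beta X)$ that are Radon, i.e. $\mu(\varphi_\alpha)\to 0$ for each (norm-)bounded net $\{\varphi_\alpha\}\subset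 C(\beta X)$ which converges to zero uniformly on compact subsets of $X$; - $O_\beta(X)=\{\mu\in O(\beta X): \operatorname{supp}\mu\subset X\}$; - $O_\omega(X)=\{\mu\in O(\beta X): \operatorname{supp}\mu\subset X\text{ and }\operatorname{supp}\mu\text{ is finite}\}$. All these spaces carry the topology of pointwise convergence on $C(\beta X)$. The weak density $wd(X)$ of a topological space $X$ is the least cardinal number $\tau$ such that $X$ has a $\pi$-base which is the union of $\tau$ centered families of open sets in $X$. (A $\pi$-base is a family of nonempty open sets such that every nonempty open set contains a member of the family; a family is centered if every finite subfamily has nonempty intersection.) *)

theory Defs
  imports "HOL-Analysis.Analysis"
begin

no_notation Set_Algebras.elt_set_eq (infix \<open>=o\<close> 50)
unbundle cardinal_syntax

definition pi_base_in :: "'a topology \<Rightarrow> 'a set set \<Rightarrow> bool" where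
  "pi_base_in X B \<longleftrightarrow>
     (\<forall>U\<in>B. openin X U \<and> U \<noteq> {}) \<and>
     (\<forall>V. openin X V \<and> V \<noteq> {} \<longrightarrow> (\<exists>U\<in>B. U \<subseteq> V))"

definition centered_family :: "'a set set \<Rightarrow> bool" where
  "centered_family \<F> \<longleftrightarrow> (\<forall>\<G>. finite \<G> \<and> \<G> \<noteq> {} \<and> \<G> \<subseteq> \<F> \<longrightarrow> \<Inter>\<G> \<noteq> {})"

definition has_centered_pi_base :: "'a topology \<Rightarrow> 'i rel \<Rightarrow> bool" where
  "has_centered_pi_base X \<tau> \<longleftrightarrow>
     (\<exists>\<F>. (\<forall>i\<in>Field \<tau>. centered_family (\<F> i)) \<and> pi_base_in X (\<Union>i\<in>Field \<tau>. \<F> i))"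

text \<open>Cardinals are cardinal orders, compared up to \<open>=o\<close>. The weak density is picked among those
  on the type \<^typ>\<open>'a set\<close>; this is no restriction, by \<open>has_centered_pi_base_wd\<close> and
  \<open>wd_least\<close> below, the latter of which compares with cardinals on an arbitrary type.\<close>

definition wd :: "'a topology \<Rightarrow> 'a set rel" where
  "wd X = (SOME \<tau>. Card_order \<tau> \<and> has_centered_pi_base X \<tau> \<and>
     (\<forall>\<sigma> :: 'a set rel. Card_order \<sigma> \<and> has_centered_pi_base X \<sigma> \<longrightarrow> \<tau> \<le>o \<sigma>))"

lemma has_centered_pi_base_open_sets:
  "has_centered_pi_base X |{U. openin X U \<and> U \<noteq> {}}|"
  unfolding has_centered_pi_base_def
proof (intro exI conjI)
  show "\<forall>U\<in>Field |{U. openin X U \<and> U \<noteq> {}}|. centered_family {U}"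
  proof
    fix U assume "U \<in> Field |{U. openin X U \<and> U \<noteq> {}}|"
    then have "U \<noteq> {}" by (simp add: Field_card_of)
    then show "centered_family {U}"
      unfolding centered_family_def by (metis cInf_singleton subset_singletonD)
  qed
  show "pi_base_in X (\<Union>U\<in>Field |{U. openin X U \<and> U \<noteq> {}}|. {U})"
    by (auto simp: pi_base_in_def Field_card_of)
qed

lemma wd_works:
  fixes X :: "'a topology"
  shows "Card_order (wd X) \<and> has_centered_pi_base X (wd X) \<and>
     (\<forall>\<sigma> :: 'a set rel. Card_order \<sigma> \<and> has_centered_pi_base X \<sigma> \<longrightarrow> wd X \<le>o \<sigma>)"
proof -
  let ?R = "{\<tau> :: 'a set rel. Card_order \<tau> \<and> has_centered_pi_base X \<tau>}"
  have "|{U. openin X U \<and> U \<noteq> {}}| \<in> ?R"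
    by (simp add: has_centered_pi_base_open_sets card_of_Card_order)
  then obtain \<tau> where "\<tau> \<in> ?R" "\<forall>\<sigma>\<in>?R. \<tau> \<le>o \<sigma>"
    using exists_minim_Card_order[of ?R] by blast
  then have "\<exists>\<tau> :: 'a set rel. Card_order \<tau> \<and> has_centered_pi_base X \<tau> \<and>
     (\<forall>\<sigma> :: 'a set rel. Card_order \<sigma> \<and> has_centered_pi_base X \<sigma> \<longrightarrow> \<tau> \<le>o \<sigma>)"
    by (intro exI[of _ \<tau>]) auto
  from someI_ex[OF this] show ?thesis
    unfolding wd_def .
qed

lemma Card_order_wd: "Card_order (wd X)"
  and has_centered_pi_base_wd: "has_centered_pi_base X (wd X)"
  using wd_works by blast+

lemma wd_least:
  fixes X :: "'a topology" and \<sigma> :: "'i rel"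
  assumes "Card_order \<sigma>" "has_centered_pi_base X \<sigma>"
  shows "wd X \<le>o \<sigma>"
proof -
  let ?O = "{U. openin X U \<and> U \<noteq> {}}"
  have O: "wd X \<le>o |?O|"
    using wd_works[of X] has_centered_pi_base_open_sets[of X] card_of_Card_order by blast
  have \<sigma>: "\<sigma> =o |Field \<sigma>|"
    using assms(1) by (simp add: card_of_unique)
  consider "|?O| \<le>o |Field \<sigma>|" | "|Field \<sigma>| \<le>o |?O|"
    using ordLeq_total[OF card_of_Well_order card_of_Well_order] by blast
  then show ?thesis
  proof cases
    case 1
    then show ?thesis
      using ordLeq_ordIso_trans[OF ordLeq_transitive[OF O 1] ordIso_symmetric[OF \<sigma>]] by simp
  next
    case 2
    then obtain g :: "'i \<Rightarrow> 'a set" where g: "inj_on g (Field \<sigma>)"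
      unfolding card_of_ordLeq[symmetric] by blast
    obtain \<F> where \<F>: "\<forall>i\<in>Field \<sigma>. centered_family (\<F> i)" "pi_base_in X (\<Union>i\<in>Field \<sigma>. \<F> i)"
      using assms(2) unfolding has_centered_pi_base_def by blast
    have "has_centered_pi_base X |g ` Field \<sigma>|"
      unfolding has_centered_pi_base_def
      by (rule exI[of _ "\<lambda>j. \<F> (inv_into (Field \<sigma>) g j)"])
        (use \<F> g in \<open>simp add: Field_card_of\<close>)
    then have "wd X \<le>o |g ` Field \<sigma>|"
      using wd_works[of X] card_of_Card_order by blast
    also have "|g ` Field \<sigma>| \<le>o |Field \<sigma>|"
      by (rule card_of_image)
    finally show ?thesis
      using ordLeq_ordIso_trans[OF _ ordIso_symmetric[OF \<sigma>]] by blast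
  qed
qed

text \<open>Functions on a space \<open>K\<close> are represented by functions on the underlying type that are
  \<^const>\<open>undefined\<close> outside \<^term>\<open>topspace K\<close>.\<close>

definition unit_cfuns :: "'a topology \<Rightarrow> ('a \<Rightarrow> real) set" where
  "unit_cfuns X = {f \<in> extensional (topspace X). continuous_map X (top_of_set {0..1}) f}"

definition unit_cube :: "'a topology \<Rightarrow> (('a \<Rightarrow> real) \<Rightarrow> real) topology" where
  "unit_cube X = product_topology (\<lambda>f. top_of_set {0..1}) (unit_cfuns X)"

definition sc_embed :: "'a topology \<Rightarrow> 'a \<Rightarrow> ('a \<Rightarrow> real) \<Rightarrow> real" where
  "sc_embed X x = (\<lambda>f\<in>unit_cfuns X. f x)"

definition Stone_Cech :: "'a topology \<Rightarrow> (('a \<Rightarrow> real) \<Rightarrow> real) topology" where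
  "Stone_Cech X = subtopology (unit_cube X) (unit_cube X closure_of (sc_embed X ` topspace X))"

lemma sc_embed_in_cube: "x \<in> topspace X \<Longrightarrow> sc_embed X x \<in> topspace (unit_cube X)"
  by (auto simp: sc_embed_def unit_cube_def unit_cfuns_def continuous_map_def Pi_iff)

lemma compact_Stone_Cech: "compact_space (Stone_Cech X)"
  unfolding Stone_Cech_def
  by (intro compact_space_subtopology closedin_compact_space closedin_closure_of)
    (simp add: unit_cube_def compact_space_product_topology compact_space_subtopology)

lemma Hausdorff_Stone_Cech: "Hausdorff_space (Stone_Cech X)"
  unfolding Stone_Cech_def unit_cube_def
  by (simp add: Hausdorff_space_subtopology Hausdorff_space_product_topology)

lemma dense_Stone_Cech:
  "Stone_Cech X closure_of (sc_embed X ` topspace X) = topspace (Stone_Cech X)"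
proof -
  have "sc_embed X ` topspace X \<subseteq> unit_cube X closure_of (sc_embed X ` topspace X)"
    by (intro closure_of_subset) (auto simp: sc_embed_in_cube)
  then show ?thesis
    unfolding Stone_Cech_def
    by (simp add: closure_of_subtopology Int_absorb1 closure_of_subset_topspace)
qed

lemma embedding_Stone_Cech:
  assumes "completely_regular_space X" "Hausdorff_space X"
  shows "embedding_map X (Stone_Cech X) (sc_embed X)"
proof -
  have "mspace (submetric (cfunspace X euclidean_metric) {f. f \<in> topspace X \<rightarrow> {0..1}}) = unit_cfuns X"
    (is "?M = _")
  proof (intro set_eqI iffI)
    fix f assume "f \<in> ?M"
    then show "f \<in> unit_cfuns X"
      by (auto simp: unit_cfuns_def continuous_map_in_subtopology)
  next
    fix f assume f: "f \<in> unit_cfuns X"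
    then have "f ` topspace X \<subseteq> {0..1}" "continuous_map X euclideanreal f"
      by (auto simp: unit_cfuns_def continuous_map_in_subtopology)
    moreover have "bounded (f ` topspace X)"
      using calculation(1) bounded_subset bounded_closed_interval by blast
    ultimately show "f \<in> ?M"
      using f by (auto simp: unit_cfuns_def)
  qed
  then have "embedding_map X (unit_cube X) (sc_embed X)"
    using completely_regular_space_cube_embedding_explicit[OF assms]
    unfolding unit_cube_def sc_embed_def[abs_def] by simp
  moreover have "sc_embed X ` topspace X \<subseteq> unit_cube X closure_of (sc_embed X ` topspace X)"
    by (intro closure_of_subset) (auto simp: sc_embed_in_cube)
  ultimately show ?thesis
    unfolding Stone_Cech_def by (simp add: embedding_map_in_subtopology)
qed

lemma extension_Stone_Cech:
  assumes f: "continuous_map X euclideanreal f" and b: "bounded (f ` topspace X)"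
  obtains g where "continuous_map (Stone_Cech X) euclideanreal g"
    "\<And>x. x \<in> topspace X \<Longrightarrow> g (sc_embed X x) = f x"
proof -
  obtain B where B: "B > 0" "\<And>x. x \<in> topspace X \<Longrightarrow> \<bar>f x\<bar> \<le> B"
    using b unfolding bounded_pos by auto
  define h where "h = (\<lambda>x\<in>topspace X. (f x + B) / (2 * B))"
  have "continuous_map X euclideanreal (\<lambda>x. (f x + B) / (2 * B))"
    using f B by (intro continuous_intros) auto
  moreover have "(f x + B) / (2 * B) \<in> {0..1}" if "x \<in> topspace X" for x
    using B(1) B(2)[OF that] by (auto simp: divide_simps)
  ultimately have "continuous_map X (top_of_set {0..1}) h"
    unfolding h_def by (auto simp: continuous_map_in_subtopology intro: continuous_map_eq)
  then have h: "h \<in> unit_cfuns X"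
    by (simp add: unit_cfuns_def h_def)
  have "continuous_map (unit_cube X) (top_of_set {0..1}) (\<lambda>p. p h)"
    unfolding unit_cube_def using h by (rule continuous_map_product_projection)
  then have "continuous_map (Stone_Cech X) euclideanreal (\<lambda>p. p h)"
    unfolding Stone_Cech_def
    by (auto simp: continuous_map_in_subtopology intro: continuous_map_from_subtopology)
  then have "continuous_map (Stone_Cech X) euclideanreal (\<lambda>p. 2 * B * p h - B)"
    by (intro continuous_intros) auto
  moreover have "2 * B * sc_embed X x h - B = f x" if "x \<in> topspace X" for x
    using h that B(1) by (simp add: sc_embed_def h_def)
  ultimately show ?thesis
    using that by blast
qed

definition cfuns :: "'b topology \<Rightarrow> ('b \<Rightarrow> real) set" where
  "cfuns K = {\<phi> \<in> extensional (topspace K). continuous_map K euclideanreal \<phi>}"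

definition const_fun :: "'b topology \<Rightarrow> real \<Rightarrow> 'b \<Rightarrow> real" where
  "const_fun K c = (\<lambda>x\<in>topspace K. c)"

definition O_functionals :: "'b topology \<Rightarrow> (('b \<Rightarrow> real) \<Rightarrow> real) set" where
  "O_functionals K = {\<mu> \<in> extensional (cfuns K).
     (\<forall>\<phi>\<in>cfuns K. \<forall>\<psi>\<in>cfuns K. (\<forall>x\<in>topspace K. \<phi> x \<le> \<psi> x) \<longrightarrow> \<mu> \<phi> \<le> \<mu> \<psi>) \<and>
     (\<forall>\<phi>\<in>cfuns K. \<forall>c. \<mu> (\<lambda>x\<in>topspace K. \<phi> x + const_fun K c x) = \<mu> \<phi> + c * \<mu> (const_fun K 1)) \<and>
     \<mu> (const_fun K 1) = 1}"

definition supported_on :: "'b topology \<Rightarrow> (('b \<Rightarrow> real) \<Rightarrow> real) \<Rightarrow> 'b set \<Rightarrow> bool" where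
  "supported_on K \<mu> A \<longleftrightarrow>
     (\<exists>\<nu>\<in>O_functionals (subtopology K A). \<mu> = (\<lambda>\<phi>\<in>cfuns K. \<nu> (restrict \<phi> A)))"

definition support :: "'b topology \<Rightarrow> (('b \<Rightarrow> real) \<Rightarrow> real) \<Rightarrow> 'b set" where
  "support K \<mu> = \<Inter>{A. closedin K A \<and> supported_on K \<mu> A}"

definition pointwise_topology ::
    "'b topology \<Rightarrow> (('b \<Rightarrow> real) \<Rightarrow> real) set \<Rightarrow> (('b \<Rightarrow> real) \<Rightarrow> real) topology" where
  "pointwise_topology K S = subtopology (product_topology (\<lambda>\<phi>. euclideanreal) (cfuns K)) S"

lemma topspace_pointwise_topology:
  assumes "S \<subseteq> O_functionals K"
  shows "topspace (pointwise_topology K S) = S"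
  using assms by (auto simp: pointwise_topology_def O_functionals_def PiE_def)

definition directed_on :: "'i set \<Rightarrow> ('i \<Rightarrow> 'i \<Rightarrow> bool) \<Rightarrow> bool" where
  "directed_on D r \<longleftrightarrow> D \<noteq> {} \<and> reflp_on D r \<and> transp_on D r \<and>
     (\<forall>\<alpha>\<in>D. \<forall>\<beta>\<in>D. \<exists>\<gamma>\<in>D. r \<alpha> \<gamma> \<and> r \<beta> \<gamma>)"

definition along :: "'i set \<Rightarrow> ('i \<Rightarrow> 'i \<Rightarrow> bool) \<Rightarrow> 'i filter" where
  "along D r = (INF \<alpha>\<in>D. principal {\<beta>\<in>D. r \<alpha> \<beta>})"

lemma eventually_along:
  assumes "directed_on D r"
  shows "eventually P (along D r) \<longleftrightarrow> (\<exists>\<alpha>\<in>D. \<forall>\<beta>\<in>D. r \<alpha> \<beta> \<longrightarrow> P \<beta>)"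
proof -
  have D: "D \<noteq> {}" "transp_on D r" "\<And>\<alpha> \<beta>. \<alpha> \<in> D \<Longrightarrow> \<beta> \<in> D \<Longrightarrow> \<exists>\<gamma>\<in>D. r \<alpha> \<gamma> \<and> r \<beta> \<gamma>"
    using assms unfolding directed_on_def by auto
  have "eventually P (along D r) \<longleftrightarrow> (\<exists>\<alpha>\<in>D. eventually P (principal {\<beta>\<in>D. r \<alpha> \<beta>}))"
    unfolding along_def
  proof (rule eventually_INF_base)
    show "D \<noteq> {}" by (fact D)
    fix \<alpha> \<beta> assume ab: "\<alpha> \<in> D" "\<beta> \<in> D"
    then obtain \<gamma> where "\<gamma> \<in> D" "r \<alpha> \<gamma>" "r \<beta> \<gamma>" using D(3) by blast
    then show "\<exists>\<gamma>\<in>D. principal {\<delta>\<in>D. r \<gamma> \<delta>} \<le> inf (principal {\<delta>\<in>D. r \<alpha> \<delta>}) (principal {\<delta>\<in>D. r \<beta> \<delta>})"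
      using ab D(2) by (auto intro!: bexI[of _ \<gamma>] dest: transp_onD)
  qed
  then show ?thesis by (auto simp: eventually_principal)
qed

type_synonym 'a sc_fun = "(('a \<Rightarrow> real) \<Rightarrow> real) \<Rightarrow> real"

definition decreasing_to_zero_on ::
    "'a topology \<Rightarrow> 'i set \<Rightarrow> ('i \<Rightarrow> 'i \<Rightarrow> bool) \<Rightarrow> ('i \<Rightarrow> 'a sc_fun) \<Rightarrow> bool" where
  "decreasing_to_zero_on X D r \<phi> \<longleftrightarrow>
     (\<forall>x\<in>topspace X. (\<forall>\<alpha>\<in>D. \<forall>\<beta>\<in>D. r \<alpha> \<beta> \<longrightarrow> \<phi> \<beta> (sc_embed X x) \<le> \<phi> \<alpha> (sc_embed X x)) \<and>
        ((\<lambda>\<alpha>. \<phi> \<alpha> (sc_embed X x)) \<longlongrightarrow> 0) (along D r))"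

definition bounded_zero_on_compacts ::
    "'a topology \<Rightarrow> 'i set \<Rightarrow> ('i \<Rightarrow> 'i \<Rightarrow> bool) \<Rightarrow> ('i \<Rightarrow> 'a sc_fun) \<Rightarrow> bool" where
  "bounded_zero_on_compacts X D r \<phi> \<longleftrightarrow>
     (\<exists>M. \<forall>\<alpha>\<in>D. \<forall>p\<in>topspace (Stone_Cech X). \<bar>\<phi> \<alpha> p\<bar> \<le> M) \<and>
     (\<forall>Q. compactin X Q \<longrightarrow> uniform_limit Q (\<lambda>\<alpha> x. \<phi> \<alpha> (sc_embed X x)) (\<lambda>x. 0) (along D r))"

text \<open>A definition cannot quantify over index types. The nets in the next two definitions are
  indexed by subsets of one fixed type, which is large enough: by \<open>O_tau_net\<close> and
  \<open>O_radon_net\<close> below the same property follows for nets over an arbitrary index type.\<close>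

definition O_tau :: "'a topology \<Rightarrow> ('a sc_fun \<Rightarrow> real) set" where
  "O_tau X = {\<mu> \<in> O_functionals (Stone_Cech X).
     \<forall>(D :: ('a sc_fun \<times> 'a sc_fun set) set) r \<phi>.
       directed_on D r \<and> \<phi> ` D \<subseteq> cfuns (Stone_Cech X) \<and> decreasing_to_zero_on X D r \<phi> \<longrightarrow>
       ((\<lambda>\<alpha>. \<mu> (\<phi> \<alpha>)) \<longlongrightarrow> 0) (along D r)}"

definition O_radon :: "'a topology \<Rightarrow> ('a sc_fun \<Rightarrow> real) set" where
  "O_radon X = {\<mu> \<in> O_functionals (Stone_Cech X).
     \<forall>(D :: ('a sc_fun \<times> 'a sc_fun set) set) r \<phi>.
       directed_on D r \<and> \<phi> ` D \<subseteq> cfuns (Stone_Cech X) \<and> bounded_zero_on_compacts X D r \<phi> \<longrightarrow>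
       ((\<lambda>\<alpha>. \<mu> (\<phi> \<alpha>)) \<longlongrightarrow> 0) (along D r)}"

definition O_beta :: "'a topology \<Rightarrow> ('a sc_fun \<Rightarrow> real) set" where
  "O_beta X = {\<mu> \<in> O_functionals (Stone_Cech X).
     support (Stone_Cech X) \<mu> \<subseteq> sc_embed X ` topspace X}"

definition O_omega :: "'a topology \<Rightarrow> ('a sc_fun \<Rightarrow> real) set" where
  "O_omega X = {\<mu> \<in> O_functionals (Stone_Cech X).
     support (Stone_Cech X) \<mu> \<subseteq> sc_embed X ` topspace X \<and> finite (support (Stone_Cech X) \<mu>)}"

lemma O_tau_net:
  fixes X :: "'a topology" and D :: "'i set"
  assumes \<mu>: "\<mu> \<in> O_tau X" and D: "directed_on D r" and \<phi>: "\<phi> ` D \<subseteq> cfuns (Stone_Cech X)"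
    and dec: "decreasing_to_zero_on X D r \<phi>"
  shows "((\<lambda>\<alpha>. \<mu> (\<phi> \<alpha>)) \<longlongrightarrow> 0) (along D r)"
proof -
  define E where "E = (\<lambda>\<alpha>. (\<phi> \<alpha>, {} :: 'a sc_fun set)) ` D"
  define s where "s = (\<lambda>(p :: 'a sc_fun \<times> 'a sc_fun set) (q :: 'a sc_fun \<times> 'a sc_fun set).
    \<forall>x\<in>topspace X. fst q (sc_embed X x) \<le> fst p (sc_embed X x))"
  have mono: "\<phi> \<beta> (sc_embed X x) \<le> \<phi> \<alpha> (sc_embed X x)"
    if "x \<in> topspace X" "\<alpha> \<in> D" "\<beta> \<in> D" "r \<alpha> \<beta>" for x \<alpha> \<beta>
    using dec that unfolding decreasing_to_zero_on_def by blast
  have lim: "\<exists>\<alpha>\<in>D. \<forall>\<beta>\<in>D. r \<alpha> \<beta> \<longrightarrow> \<bar>\<phi> \<beta> (sc_embed X x)\<bar> < e"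
    if "x \<in> topspace X" "e > 0" for x e
    using dec that unfolding decreasing_to_zero_on_def tendsto_iff eventually_along[OF D] by simp
  have E: "directed_on E s"
    unfolding directed_on_def
  proof (intro conjI ballI)
    show "E \<noteq> {}" using D by (auto simp: E_def directed_on_def)
    show "reflp_on E s" by (auto simp: reflp_on_def s_def)
    show "transp_on E s" unfolding transp_on_def s_def by (meson order_trans)
    fix p q assume "p \<in> E" "q \<in> E"
    then obtain \<alpha> \<beta> where ab: "\<alpha> \<in> D" "\<beta> \<in> D" "p = (\<phi> \<alpha>, {})" "q = (\<phi> \<beta>, {})"
      by (auto simp: E_def)
    then obtain \<gamma> where "\<gamma> \<in> D" "r \<alpha> \<gamma>" "r \<beta> \<gamma>"
      using D unfolding directed_on_def by blast
    then show "\<exists>t\<in>E. s p t \<and> s q t"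
      using ab by (intro bexI[of _ "(\<phi> \<gamma>, {})"]) (auto simp: s_def E_def mono)
  qed
  have nonneg: "0 \<le> \<phi> \<alpha> (sc_embed X x)" if x: "x \<in> topspace X" and \<alpha>: "\<alpha> \<in> D" for x \<alpha>
  proof (rule ccontr)
    assume "\<not> 0 \<le> \<phi> \<alpha> (sc_embed X x)"
    then obtain \<beta> where \<beta>: "\<beta> \<in> D" "\<And>\<gamma>. \<gamma> \<in> D \<Longrightarrow> r \<beta> \<gamma> \<Longrightarrow> \<bar>\<phi> \<gamma> (sc_embed X x)\<bar> < - \<phi> \<alpha> (sc_embed X x)"
      using lim[OF x, of "- \<phi> \<alpha> (sc_embed X x)"] by auto
    obtain \<gamma> where \<gamma>: "\<gamma> \<in> D" "r \<alpha> \<gamma>" "r \<beta> \<gamma>"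
      using D \<alpha> \<beta>(1) unfolding directed_on_def by blast
    show False
      using \<beta>(2)[OF \<gamma>(1,3)] mono[OF x \<alpha> \<gamma>(1,2)] by linarith
  qed
  have "decreasing_to_zero_on X E s fst"
    unfolding decreasing_to_zero_on_def tendsto_iff eventually_along[OF E]
  proof (intro ballI conjI allI impI)
    fix x e assume x: "x \<in> topspace X" and e: "(0::real) < e"
    obtain \<alpha> where \<alpha>: "\<alpha> \<in> D" "\<And>\<beta>. \<beta> \<in> D \<Longrightarrow> r \<alpha> \<beta> \<Longrightarrow> \<bar>\<phi> \<beta> (sc_embed X x)\<bar> < e"
      using lim[OF x e] by blast
    have "\<bar>\<phi> \<alpha> (sc_embed X x)\<bar> < e"
      using D \<alpha> unfolding directed_on_def by (auto dest: reflp_onD)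
    then show "\<exists>p\<in>E. \<forall>q\<in>E. s p q \<longrightarrow> dist (fst q (sc_embed X x)) 0 < e"
      using \<alpha>(1) x nonneg[OF x] by (intro bexI[of _ "(\<phi> \<alpha>, {})"]) (force simp: E_def s_def)+
  qed (auto simp: s_def)
  moreover have "fst ` E \<subseteq> cfuns (Stone_Cech X)"
    using \<phi> by (auto simp: E_def)
  ultimately have conv: "((\<lambda>p. \<mu> (fst p)) \<longlongrightarrow> 0) (along E s)"
    using \<mu> E unfolding O_tau_def by blast
  show ?thesis
    unfolding tendsto_iff eventually_along[OF D]
  proof (intro allI impI)
    fix e :: real assume "e > 0"
    then obtain p where p: "p \<in> E" "\<And>q. q \<in> E \<Longrightarrow> s p q \<Longrightarrow> dist (\<mu> (fst q)) 0 < e"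
      using conv unfolding tendsto_iff eventually_along[OF E] by blast
    then obtain \<alpha> where \<alpha>: "\<alpha> \<in> D" "p = (\<phi> \<alpha>, {})" by (auto simp: E_def)
    have "dist (\<mu> (\<phi> \<beta>)) 0 < e" if "\<beta> \<in> D" "r \<alpha> \<beta>" for \<beta>
      using p(2)[of "(\<phi> \<beta>, {})"] that \<alpha> by (auto simp: E_def s_def mono)
    then show "\<exists>\<alpha>\<in>D. \<forall>\<beta>\<in>D. r \<alpha> \<beta> \<longrightarrow> dist (\<mu> (\<phi> \<beta>)) 0 < e"
      using \<alpha>(1) by blast
  qed
qed

lemma O_radon_net:
  fixes X :: "'a topology" and D :: "'i set"
  assumes \<mu>: "\<mu> \<in> O_radon X" and D: "directed_on D r" and \<phi>: "\<phi> ` D \<subseteq> cfuns (Stone_Cech X)"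
    and bzc: "bounded_zero_on_compacts X D r \<phi>"
  shows "((\<lambda>\<alpha>. \<mu> (\<phi> \<alpha>)) \<longlongrightarrow> 0) (along D r)"
proof -
  define T where "T = (\<lambda>\<alpha>. \<phi> ` {\<beta>\<in>D. r \<alpha> \<beta>})"
  define E where "E = {(c, A). \<exists>\<alpha>\<in>D. A = T \<alpha> \<and> c \<in> A}"
  define s where "s = (\<lambda>(p :: 'a sc_fun \<times> 'a sc_fun set) (q :: 'a sc_fun \<times> 'a sc_fun set). snd q \<subseteq> snd p)"
  have refl: "r \<alpha> \<alpha>" if "\<alpha> \<in> D" for \<alpha>
    using D that unfolding directed_on_def by (auto dest: reflp_onD)
  have inE: "(\<phi> \<beta>, T \<alpha>) \<in> E" if "\<alpha> \<in> D" "\<beta> \<in> D" "r \<alpha> \<beta>" for \<alpha> \<beta>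
    using that by (auto simp: E_def T_def)
  have T_mono: "T \<beta> \<subseteq> T \<alpha>" if "\<alpha> \<in> D" "\<beta> \<in> D" "r \<alpha> \<beta>" for \<alpha> \<beta>
  proof -
    have "transp_on D r" using D by (simp add: directed_on_def)
    then show ?thesis unfolding T_def using that by (auto dest: transp_onD)
  qed
  have E: "directed_on E s"
    unfolding directed_on_def
  proof (intro conjI ballI)
    obtain \<alpha> where "\<alpha> \<in> D" using D by (auto simp: directed_on_def)
    then show "E \<noteq> {}" using inE refl by blast
    show "reflp_on E s" by (auto simp: reflp_on_def s_def)
    show "transp_on E s" by (auto simp: transp_on_def s_def)
    fix p q assume "p \<in> E" "q \<in> E"
    then obtain \<alpha> \<beta> where ab: "\<alpha> \<in> D" "\<beta> \<in> D" "snd p = T \<alpha>" "snd q = T \<beta>"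
      by (auto simp: E_def)
    then obtain \<gamma> where \<gamma>: "\<gamma> \<in> D" "r \<alpha> \<gamma>" "r \<beta> \<gamma>"
      using D unfolding directed_on_def by blast
    then show "\<exists>t\<in>E. s p t \<and> s q t"
      using ab T_mono inE[OF \<gamma>(1) \<gamma>(1)] refl
      by (intro bexI[of _ "(\<phi> \<gamma>, T \<gamma>)"]) (auto simp: s_def)
  qed
  have ev: "eventually (\<lambda>p. P (fst p)) (along E s) \<longleftrightarrow> eventually (\<lambda>\<alpha>. P (\<phi> \<alpha>)) (along D r)" for P
    unfolding eventually_along[OF D] eventually_along[OF E]
  proof
    assume "\<exists>p\<in>E. \<forall>q\<in>E. s p q \<longrightarrow> P (fst q)"
    then obtain p where p: "p \<in> E" "\<And>q. q \<in> E \<Longrightarrow> s p q \<Longrightarrow> P (fst q)" by blast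
    then obtain \<alpha> where \<alpha>: "\<alpha> \<in> D" "snd p = T \<alpha>" by (auto simp: E_def)
    have "P (\<phi> \<beta>)" if "\<beta> \<in> D" "r \<alpha> \<beta>" for \<beta>
      using p(2)[OF inE[OF \<alpha>(1) that]] \<alpha>(2) by (simp add: s_def)
    then show "\<exists>\<alpha>\<in>D. \<forall>\<beta>\<in>D. r \<alpha> \<beta> \<longrightarrow> P (\<phi> \<beta>)" using \<alpha>(1) by blast
  next
    assume "\<exists>\<alpha>\<in>D. \<forall>\<beta>\<in>D. r \<alpha> \<beta> \<longrightarrow> P (\<phi> \<beta>)"
    then obtain \<alpha> where \<alpha>: "\<alpha> \<in> D" "\<And>\<beta>. \<beta> \<in> D \<Longrightarrow> r \<alpha> \<beta> \<Longrightarrow> P (\<phi> \<beta>)" by blast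
    have "P (fst q)" if "q \<in> E" "s (\<phi> \<alpha>, T \<alpha>) q" for q
    proof -
      have "fst q \<in> T \<alpha>" using that by (auto simp: E_def s_def)
      then show ?thesis using \<alpha>(2) by (auto simp: T_def)
    qed
    then show "\<exists>p\<in>E. \<forall>q\<in>E. s p q \<longrightarrow> P (fst q)"
      using inE[OF \<alpha>(1) \<alpha>(1) refl[OF \<alpha>(1)]] by blast
  qed
  have sub: "fst ` E \<subseteq> \<phi> ` D"
    by (auto simp: E_def T_def)
  have "bounded_zero_on_compacts X E s fst"
    unfolding bounded_zero_on_compacts_def
  proof (intro conjI allI impI)
    obtain M where "\<forall>\<alpha>\<in>D. \<forall>p\<in>topspace (Stone_Cech X). \<bar>\<phi> \<alpha> p\<bar> \<le> M"
      using bzc unfolding bounded_zero_on_compacts_def by blast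
    then show "\<exists>M. \<forall>\<alpha>\<in>E. \<forall>p\<in>topspace (Stone_Cech X). \<bar>fst \<alpha> p\<bar> \<le> M"
      using sub by (intro exI[of _ M]) fastforce
    fix Q assume "compactin X Q"
    then have "uniform_limit Q (\<lambda>\<alpha> x. \<phi> \<alpha> (sc_embed X x)) (\<lambda>x. 0) (along D r)"
      using bzc unfolding bounded_zero_on_compacts_def by blast
    then show "uniform_limit Q (\<lambda>p x. fst p (sc_embed X x)) (\<lambda>x. 0) (along E s)"
      unfolding uniform_limit_iff
      using ev[of "\<lambda>c. \<forall>x\<in>Q. dist (c (sc_embed X x)) 0 < e" for e] by blast
  qed
  moreover have "fst ` E \<subseteq> cfuns (Stone_Cech X)"
    using sub \<phi> by blast
  ultimately have "((\<lambda>p. \<mu> (fst p)) \<longlongrightarrow> 0) (along E s)"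
    using \<mu> E unfolding O_radon_def by blast
  then show ?thesis
    unfolding tendsto_iff using ev[of "\<lambda>c. dist (\<mu> c) 0 < e" for e] by blast
qed

end

theory Submission
  imports Defs
begin

text \<open>Passing to a dense subspace does not change the weak density, so it is enough to find one set of
  functionals that lies in all four spaces and is dense in \<^term>\<open>O_functionals (Stone_Cech X)\<close>. The
  functionals supported on some finite subset of \<open>X\<close> form such a set.

  Such a finite set is closed in the compactification, so it contains the support, which is therefore
  finite and inside \<open>X\<close>. The two continuity conditions hold because the value of such a functional is controlled by the values of
  its argument on finitely many points of \<open>X\<close>, where pointwise convergence is already uniform.

  For density, let \<open>\<mu>\<close>, finitely many functions \<open>\<phi> \<in> J\<close> and \<open>\<delta> > 0\<close> be given. Since \<open>X\<close> is dense in its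
  compactification, there is a finite set \<open>F\<close> of points of \<open>X\<close> on which every gap \<open>\<mu> \<phi> - \<mu> \<psi>\<close> is
  reached by \<open>\<phi> - \<psi>\<close> up to \<open>\<delta>\<close> (\<open>O_functionals_gap_witness\<close>). The functional
  \<open>f \<mapsto> max\<^sub>\<phi> (\<mu> \<phi> + min\<^sub>F (f - \<phi>))\<close> is monotone, commutes with adding constants and depends only on
  the restriction of \<open>f\<close> to \<open>F\<close>; the choice of \<open>F\<close> makes it agree with \<open>\<mu>\<close> on \<open>J\<close> up to \<open>\<delta>\<close>. Subtracting
  its value at \<open>0\<close>, which is small, normalizes it (\<open>finitely_supported_approx\<close>).\<close>

section \<open>Weak density of dense subspaces\<close>

text \<open>Finitely many open sets of \<open>Z\<close> have a common point iff their traces on \<open>S\<close> do, because their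
  intersection is open and \<open>S\<close> is dense. Hence centered families of \<open>Z\<close> can be traced to \<open>S\<close>, and those
  of \<open>S\<close> can be replaced by all open sets of \<open>Z\<close> whose traces belong to them.\<close>

lemma wd_dense_subspace:
  assumes S: "S \<subseteq> topspace Z"
    and dense: "\<And>V. openin Z V \<Longrightarrow> V \<noteq> {} \<Longrightarrow> V \<inter> S \<noteq> {}"
  shows "wd (subtopology Z S) =o wd Z"
  unfolding ordIso_iff_ordLeq
proof (intro conjI wd_least Card_order_wd)
  obtain \<F> where cent: "\<forall>i\<in>Field (wd Z). centered_family (\<F> i)"
    and pi: "pi_base_in Z (\<Union>i\<in>Field (wd Z). \<F> i)"
    using has_centered_pi_base_wd unfolding has_centered_pi_base_def by blast
  define \<G> where "\<G> i = (\<lambda>U. U \<inter> S) ` \<F> i" for i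
  have "centered_family (\<G> i)" if i: "i \<in> Field (wd Z)" for i
    unfolding centered_family_def
  proof (intro allI impI, elim conjE)
    fix \<H> assume \<H>: "finite \<H>" "\<H> \<noteq> {}" "\<H> \<subseteq> \<G> i"
    then obtain \<K> where \<K>: "\<K> \<subseteq> \<F> i" "finite \<K>" "\<H> = (\<lambda>U. U \<inter> S) ` \<K>"
      unfolding \<G>_def by (meson finite_subset_image)
    with \<H> have "\<K> \<noteq> {}" by auto
    moreover have "\<forall>U\<in>\<K>. openin Z U"
      using pi \<K>(1) i unfolding pi_base_in_def by blast
    ultimately have "openin Z (\<Inter>\<K>)" "\<Inter>\<K> \<noteq> {}"
      using \<K> cent i by (auto simp: openin_Inter centered_family_def)
    then have "\<Inter>\<K> \<inter> S \<noteq> {}" by (rule dense)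
    then show "\<Inter>\<H> \<noteq> {}" using \<K>(3) by auto
  qed
  moreover have "pi_base_in (subtopology Z S) (\<Union>i\<in>Field (wd Z). \<G> i)"
    unfolding pi_base_in_def
  proof (intro conjI ballI allI impI)
    fix U assume "U \<in> (\<Union>i\<in>Field (wd Z). \<G> i)"
    then obtain W where "U = W \<inter> S" "openin Z W" "W \<noteq> {}"
      using pi unfolding pi_base_in_def \<G>_def by blast
    then show "openin (subtopology Z S) U" "U \<noteq> {}"
      using dense by (auto simp: openin_subtopology)
  next
    fix V assume "openin (subtopology Z S) V \<and> V \<noteq> {}"
    then obtain W where W: "openin Z W" "V = W \<inter> S" "W \<noteq> {}"
      by (auto simp: openin_subtopology)
    then obtain U where "U \<in> (\<Union>i\<in>Field (wd Z). \<F> i)" "U \<subseteq> W"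
      using pi unfolding pi_base_in_def by blast
    then show "\<exists>U\<in>(\<Union>i\<in>Field (wd Z). \<G> i). U \<subseteq> V"
      using W(2) unfolding \<G>_def by blast
  qed
  ultimately show "has_centered_pi_base (subtopology Z S) (wd Z)"
    unfolding has_centered_pi_base_def by blast
next
  let ?I = "Field (wd (subtopology Z S))"
  obtain \<F> where cent: "\<forall>i\<in>?I. centered_family (\<F> i)"
    and pi: "pi_base_in (subtopology Z S) (\<Union>i\<in>?I. \<F> i)"
    using has_centered_pi_base_wd unfolding has_centered_pi_base_def by blast
  define \<G> where "\<G> i = {W. openin Z W \<and> W \<inter> S \<in> \<F> i}" for i
  have "centered_family (\<G> i)" if i: "i \<in> ?I" for i
    unfolding centered_family_def
  proof (intro allI impI, elim conjE)
    fix \<H> assume \<H>: "finite \<H>" "\<H> \<noteq> {}" "\<H> \<subseteq> \<G> i"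
    then have "finite ((\<lambda>W. W \<inter> S) ` \<H>)" "(\<lambda>W. W \<inter> S) ` \<H> \<noteq> {}" "(\<lambda>W. W \<inter> S) ` \<H> \<subseteq> \<F> i"
      by (auto simp: \<G>_def)
    then have "\<Inter>((\<lambda>W. W \<inter> S) ` \<H>) \<noteq> {}"
      using cent i unfolding centered_family_def by blast
    with \<H>(2) show "\<Inter>\<H> \<noteq> {}" by auto
  qed
  moreover have "pi_base_in Z (\<Union>i\<in>?I. \<G> i)"
    unfolding pi_base_in_def
  proof (intro conjI ballI allI impI)
    fix U assume U: "U \<in> (\<Union>i\<in>?I. \<G> i)"
    then show "openin Z U" by (auto simp: \<G>_def)
    have "U \<inter> S \<in> (\<Union>i\<in>?I. \<F> i)" using U by (auto simp: \<G>_def)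
    then show "U \<noteq> {}" using pi unfolding pi_base_in_def by blast
  next
    fix V assume V: "openin Z V \<and> V \<noteq> {}"
    then have "openin (subtopology Z S) (V \<inter> S)" "V \<inter> S \<noteq> {}"
      using dense by (auto simp: openin_subtopology)
    then obtain U i where U: "i \<in> ?I" "U \<in> \<F> i" "U \<subseteq> V \<inter> S"
      using pi unfolding pi_base_in_def by blast
    then obtain W where W: "openin Z W" "U = W \<inter> S"
      using pi unfolding pi_base_in_def openin_subtopology by blast
    \<comment> \<open>An open extension of \<open>U\<close> may leave \<open>V\<close>; cutting it down to \<open>V\<close> does not change its trace
      on \<open>S\<close>, so the result still belongs to \<open>\<G> i\<close>.\<close>
    have "W \<inter> V \<inter> S = U" using U(3) W(2) by blast
    then have "W \<inter> V \<in> \<G> i" using U V W by (auto simp: \<G>_def)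
    then show "\<exists>U\<in>(\<Union>i\<in>?I. \<G> i). U \<subseteq> V" using U(1) by blast
  qed
  ultimately show "has_centered_pi_base Z (wd (subtopology Z S))"
    unfolding has_centered_pi_base_def by blast
qed

section \<open>Order-preserving, weakly additive, normed functionals\<close>

lemma const_fun_in_cfuns: "const_fun K c \<in> cfuns K"
  unfolding cfuns_def const_fun_def
  by (auto intro: continuous_map_eq[of K euclideanreal "\<lambda>x. c"])

lemma cfuns_add_const:
  assumes "\<phi> \<in> cfuns K"
  shows "(\<lambda>x\<in>topspace K. \<phi> x + const_fun K c x) \<in> cfuns K"
proof -
  have "continuous_map K euclideanreal (\<lambda>x. \<phi> x + c)"
    using assms by (intro continuous_intros) (auto simp: cfuns_def)
  then have "continuous_map K euclideanreal (\<lambda>x\<in>topspace K. \<phi> x + const_fun K c x)"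
    by (rule continuous_map_eq) (auto simp: const_fun_def)
  then show ?thesis by (simp add: cfuns_def)
qed

lemma O_functionals_mono:
  assumes "\<mu> \<in> O_functionals K" "\<phi> \<in> cfuns K" "\<psi> \<in> cfuns K"
    and "\<And>x. x \<in> topspace K \<Longrightarrow> \<phi> x \<le> \<psi> x"
  shows "\<mu> \<phi> \<le> \<mu> \<psi>"
  using assms unfolding O_functionals_def by blast

lemma O_functionals_add_const:
  assumes "\<mu> \<in> O_functionals K" "\<phi> \<in> cfuns K"
  shows "\<mu> (\<lambda>x\<in>topspace K. \<phi> x + const_fun K c x) = \<mu> \<phi> + c"
  using assms unfolding O_functionals_def by simp

lemma O_functionals_const:
  assumes \<mu>: "\<mu> \<in> O_functionals K"
  shows "\<mu> (const_fun K c) = c"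
proof -
  have shift: "\<mu> (const_fun K d) = \<mu> (const_fun K 0) + d" for d
  proof -
    have "const_fun K d = (\<lambda>x\<in>topspace K. const_fun K 0 x + const_fun K d x)"
      by (auto simp: const_fun_def fun_eq_iff)
    then show ?thesis
      using O_functionals_add_const[OF \<mu> const_fun_in_cfuns, of 0 d] by simp
  qed
  have "\<mu> (const_fun K 1) = 1" using \<mu> by (simp add: O_functionals_def)
  with shift[of 1] shift[of c] show ?thesis by simp
qed

lemma O_functionals_bound:
  assumes \<mu>: "\<mu> \<in> O_functionals K" and \<phi>: "\<phi> \<in> cfuns K"
    and le: "\<And>x. x \<in> topspace K \<Longrightarrow> \<bar>\<phi> x\<bar> \<le> e"
  shows "\<bar>\<mu> \<phi>\<bar> \<le> e"
proof -
  have "\<mu> \<phi> \<le> \<mu> (const_fun K e)"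
    using le by (intro O_functionals_mono[OF \<mu> \<phi> const_fun_in_cfuns]) (fastforce simp: const_fun_def)
  moreover have "\<mu> (const_fun K (- e)) \<le> \<mu> \<phi>"
    using le by (intro O_functionals_mono[OF \<mu> const_fun_in_cfuns \<phi>]) (fastforce simp: const_fun_def)
  ultimately show ?thesis
    by (simp add: O_functionals_const[OF \<mu>])
qed

text \<open>The gap between two values is witnessed at points of any dense set: if \<open>\<phi> - \<psi>\<close> stayed below
  \<open>\<mu> \<phi> - \<mu> \<psi> - \<delta>\<close> on a dense set, it would do so everywhere by continuity, and monotonicity together
  with weak additivity would bound \<open>\<mu> \<phi>\<close> by \<open>\<mu> \<phi> - \<delta>\<close>.\<close>

lemma O_functionals_gap_witness:
  assumes \<mu>: "\<mu> \<in> O_functionals K" and \<phi>: "\<phi> \<in> cfuns K" and \<psi>: "\<psi> \<in> cfuns K"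
    and dense: "K closure_of T = topspace K" and T: "T \<subseteq> topspace K" and "\<delta> > 0"
  obtains x where "x \<in> T" "\<mu> \<phi> - \<mu> \<psi> - \<delta> < \<phi> x - \<psi> x"
proof (rule ccontr)
  note witness = that
  assume no: "\<not> thesis"
  let ?c = "\<mu> \<phi> - \<mu> \<psi> - \<delta>"
  have le: "\<phi> x - \<psi> x \<le> ?c" if "x \<in> T" for x
    using no witness[of x] that by force
  have "continuous_map K euclideanreal (\<lambda>x. \<phi> x - \<psi> x)"
    using \<phi> \<psi> by (intro continuous_intros) (auto simp: cfuns_def)
  then have "closedin K {x \<in> topspace K. \<phi> x - \<psi> x \<in> {..?c}}"
    by (rule closedin_continuous_map_preimage) auto
  then have "K closure_of T \<subseteq> {x \<in> topspace K. \<phi> x - \<psi> x \<in> {..?c}}"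
    using le T by (intro closure_of_minimal) auto
  then have "\<phi> x \<le> \<psi> x + ?c" if "x \<in> topspace K" for x
    using that dense by force
  then have "\<mu> \<phi> \<le> \<mu> (\<lambda>x\<in>topspace K. \<psi> x + const_fun K ?c x)"
    by (intro O_functionals_mono[OF \<mu> \<phi> cfuns_add_const[OF \<psi>]]) (simp add: const_fun_def)
  then show False
    using O_functionals_add_const[OF \<mu> \<psi>, of ?c] \<open>\<delta> > 0\<close> by simp
qed

section \<open>Functionals supported on finite sets\<close>

lemma restrict_in_cfuns:
  assumes "\<phi> \<in> cfuns K" "A \<subseteq> topspace K"
  shows "restrict \<phi> A \<in> cfuns (subtopology K A)"
proof -
  have "continuous_map (subtopology K A) euclideanreal \<phi>"
    using assms by (simp add: cfuns_def continuous_map_from_subtopology)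
  then have "continuous_map (subtopology K A) euclideanreal (restrict \<phi> A)"
    by (rule continuous_map_eq) auto
  then show ?thesis using assms(2) by (simp add: cfuns_def inf_absorb2)
qed

lemma O_functionals_pullback:
  assumes A: "A \<subseteq> topspace K" and \<nu>: "\<nu> \<in> O_functionals (subtopology K A)"
  shows "(\<lambda>\<phi>\<in>cfuns K. \<nu> (restrict \<phi> A)) \<in> O_functionals K"
proof -
  have top: "topspace (subtopology K A) = A" using A by auto
  have const: "restrict (const_fun K c) A = const_fun (subtopology K A) c" for c
    using A by (auto simp: const_fun_def fun_eq_iff)
  have add: "restrict (\<lambda>x\<in>topspace K. \<phi> x + const_fun K c x) A =
      (\<lambda>x\<in>A. restrict \<phi> A x + const_fun (subtopology K A) c x)" for \<phi> c
    using A by (auto simp: const_fun_def fun_eq_iff)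
  show ?thesis
    unfolding O_functionals_def
  proof (intro CollectI conjI ballI allI impI)
    show "(\<lambda>\<phi>\<in>cfuns K. \<nu> (restrict \<phi> A)) \<in> extensional (cfuns K)" by simp
  next
    fix \<phi> \<psi> assume \<phi>\<psi>: "\<phi> \<in> cfuns K" "\<psi> \<in> cfuns K" "\<forall>x\<in>topspace K. \<phi> x \<le> \<psi> x"
    have "\<nu> (restrict \<phi> A) \<le> \<nu> (restrict \<psi> A)"
      using \<phi>\<psi> A by (intro O_functionals_mono[OF \<nu>] restrict_in_cfuns) auto
    then show "(\<lambda>\<phi>\<in>cfuns K. \<nu> (restrict \<phi> A)) \<phi> \<le> (\<lambda>\<phi>\<in>cfuns K. \<nu> (restrict \<phi> A)) \<psi>"
      using \<phi>\<psi> by simp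
  next
    fix \<phi> c assume \<phi>: "\<phi> \<in> cfuns K"
    then show "(\<lambda>\<phi>\<in>cfuns K. \<nu> (restrict \<phi> A)) (\<lambda>x\<in>topspace K. \<phi> x + const_fun K c x) =
        (\<lambda>\<phi>\<in>cfuns K. \<nu> (restrict \<phi> A)) \<phi> + c * (\<lambda>\<phi>\<in>cfuns K. \<nu> (restrict \<phi> A)) (const_fun K 1)"
      using O_functionals_add_const[OF \<nu> restrict_in_cfuns[OF \<phi> A], of c]
      by (simp only: restrict_apply cfuns_add_const const_fun_in_cfuns if_True const add top
          O_functionals_const[OF \<nu>] mult_1_right)
  next
    show "(\<lambda>\<phi>\<in>cfuns K. \<nu> (restrict \<phi> A)) (const_fun K 1) = 1"
      by (simp add: const_fun_in_cfuns const O_functionals_const[OF \<nu>])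
  qed
qed

definition finitely_supported :: "'b topology \<Rightarrow> 'b set \<Rightarrow> (('b \<Rightarrow> real) \<Rightarrow> real) set" where
  "finitely_supported K T = {\<mu>. \<exists>F. finite F \<and> F \<subseteq> T \<and> supported_on K \<mu> F}"

lemma finitely_supported_in_O_functionals:
  assumes "T \<subseteq> topspace K"
  shows "finitely_supported K T \<subseteq> O_functionals K"
proof
  fix \<mu> assume "\<mu> \<in> finitely_supported K T"
  then obtain F \<nu> where "F \<subseteq> T" "\<nu> \<in> O_functionals (subtopology K F)"
    "\<mu> = (\<lambda>\<phi>\<in>cfuns K. \<nu> (restrict \<phi> F))"
    by (auto simp: finitely_supported_def supported_on_def)
  with assms show "\<mu> \<in> O_functionals K"
    using O_functionals_pullback[of F K \<nu>] by auto
qed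

lemma support_finitely_supported:
  assumes \<mu>: "\<mu> \<in> finitely_supported K T" and "Hausdorff_space K" and "T \<subseteq> topspace K"
  shows "support K \<mu> \<subseteq> T" and "finite (support K \<mu>)"
proof -
  obtain F where F: "finite F" "F \<subseteq> T" "supported_on K \<mu> F"
    using \<mu> by (auto simp: finitely_supported_def)
  then have "closedin K F"
    using assms by (intro compactin_imp_closedin finite_imp_compactin) auto
  with F(3) have "support K \<mu> \<subseteq> F" by (auto simp: support_def)
  with F show "support K \<mu> \<subseteq> T" "finite (support K \<mu>)"
    by (auto intro: finite_subset)
qed

text \<open>The value of a functional on a function is bounded by the maximal modulus over a finite
  supporting set, and on a finite set pointwise convergence is uniform.\<close>

lemma finitely_supported_tendsto:
  assumes \<mu>: "\<mu> \<in> finitely_supported K T" and T: "T \<subseteq> topspace K"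
    and cf: "eventually (\<lambda>\<alpha>. \<phi> \<alpha> \<in> cfuns K) \<A>"
    and lim: "\<And>x. x \<in> T \<Longrightarrow> ((\<lambda>\<alpha>. \<phi> \<alpha> x) \<longlongrightarrow> 0) \<A>"
  shows "((\<lambda>\<alpha>. \<mu> (\<phi> \<alpha>)) \<longlongrightarrow> 0) \<A>"
  unfolding tendsto_iff
proof (intro allI impI)
  fix e :: real assume e: "e > 0"
  obtain F \<nu> where F: "finite F" "F \<subseteq> T" and \<nu>: "\<nu> \<in> O_functionals (subtopology K F)"
    and \<mu>_eq: "\<mu> = (\<lambda>\<phi>\<in>cfuns K. \<nu> (restrict \<phi> F))"
    using \<mu> by (auto simp: finitely_supported_def supported_on_def)
  have FK: "F \<subseteq> topspace K" using F T by auto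
  have "eventually (\<lambda>\<alpha>. \<forall>x\<in>F. \<bar>\<phi> \<alpha> x\<bar> < e / 2) \<A>"
    using lim F e
    by (intro eventually_ball_finite ballI order_tendstoD(2)[of _ 0] tendsto_rabs_zero) auto
  with cf show "eventually (\<lambda>\<alpha>. dist (\<mu> (\<phi> \<alpha>)) 0 < e) \<A>"
  proof eventually_elim
    case (elim \<alpha>)
    then have "\<bar>\<nu> (restrict (\<phi> \<alpha>) F)\<bar> \<le> e / 2"
      by (intro O_functionals_bound[OF \<nu> restrict_in_cfuns[OF _ FK]]) auto
    then show ?case using elim(1) e by (simp add: \<mu>_eq)
  qed
qed

section \<open>Density of the finitely supported functionals\<close>

text \<open>For prescribed values \<open>a \<phi>\<close> at finitely many functions \<open>\<phi> \<in> J\<close>, this is the least monotone and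
  translation-equivariant function of \<open>f\<close> on \<open>F\<close> that takes at least these values.\<close>

definition lower_envelope ::
    "'b set \<Rightarrow> ('b \<Rightarrow> real) set \<Rightarrow> (('b \<Rightarrow> real) \<Rightarrow> real) \<Rightarrow> ('b \<Rightarrow> real) \<Rightarrow> real" where
  "lower_envelope F J a f = Max ((\<lambda>\<phi>. a \<phi> + Min ((\<lambda>x. f x - \<phi> x) ` F)) ` J)"

lemma le_lower_envelope_iff:
  assumes "finite F" "F \<noteq> {}" "finite J" "J \<noteq> {}"
  shows "t \<le> lower_envelope F J a f \<longleftrightarrow> (\<exists>\<phi>\<in>J. \<forall>x\<in>F. t \<le> a \<phi> + (f x - \<phi> x))"
proof -
  have "t \<le> a \<phi> + Min ((\<lambda>x. f x - \<phi> x) ` F) \<longleftrightarrow> (\<forall>x\<in>F. t \<le> a \<phi> + (f x - \<phi> x))" for \<phi>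
  proof -
    have "t - a \<phi> \<le> Min ((\<lambda>x. f x - \<phi> x) ` F) \<longleftrightarrow> (\<forall>x\<in>F. t - a \<phi> \<le> f x - \<phi> x)"
      using assms by simp
    then show ?thesis by (simp add: algebra_simps)
  qed
  with assms show ?thesis
    by (simp add: lower_envelope_def Max_ge_iff)
qed

text \<open>Monotonicity and translation equivariance pass from \<open>f \<mapsto> f x - \<phi> x\<close> to minima and maxima;
  subtracting the value at \<open>0\<close> then gives value \<open>1\<close> at the constant function \<open>1\<close>.\<close>

lemma lower_envelope_O_functional:
  assumes F: "finite F" "F \<noteq> {}" "F \<subseteq> topspace K" and J: "finite J" "J \<noteq> {}"
  shows "(\<lambda>f\<in>cfuns (subtopology K F). lower_envelope F J a f - lower_envelope F J a (\<lambda>x. 0))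
    \<in> O_functionals (subtopology K F)"
proof -
  note le_iff = le_lower_envelope_iff[OF F(1,2) J, of _ a]
  have top: "topspace (subtopology K F) = F" using F(3) by auto
  have FK: "x \<in> topspace K" if "x \<in> F" for x using F(3) that by auto
  have mono: "lower_envelope F J a f \<le> lower_envelope F J a g" if "\<And>x. x \<in> F \<Longrightarrow> f x \<le> g x" for f g
  proof -
    have "\<exists>\<phi>\<in>J. \<forall>x\<in>F. lower_envelope F J a f \<le> a \<phi> + (f x - \<phi> x)"
      using le_iff by blast
    then have "\<exists>\<phi>\<in>J. \<forall>x\<in>F. lower_envelope F J a f \<le> a \<phi> + (g x - \<phi> x)"
      using that by (smt (verit, best))
    then show ?thesis using le_iff by blast
  qed
  have cong: "lower_envelope F J a f = lower_envelope F J a g" if "\<And>x. x \<in> F \<Longrightarrow> f x = g x" for f g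
    using mono[of f g] mono[of g f] that by fastforce
  have ge: "lower_envelope F J a f + c \<le> lower_envelope F J a (\<lambda>x. f x + c)" for f c
  proof -
    have "\<exists>\<phi>\<in>J. \<forall>x\<in>F. lower_envelope F J a f \<le> a \<phi> + (f x - \<phi> x)"
      using le_iff by blast
    then have "\<exists>\<phi>\<in>J. \<forall>x\<in>F. lower_envelope F J a f + c \<le> a \<phi> + ((f x + c) - \<phi> x)"
      by (smt (verit, best))
    then show ?thesis using le_iff by blast
  qed
  have shift: "lower_envelope F J a (\<lambda>x. f x + c) = lower_envelope F J a f + c" for f c
    using ge[of f c] ge[of "\<lambda>x. f x + c" "- c"] by simp
  show ?thesis
    unfolding O_functionals_def top
  proof (intro CollectI conjI ballI allI impI)
    fix \<phi> \<psi> assume "\<phi> \<in> cfuns (subtopology K F)" "\<psi> \<in> cfuns (subtopology K F)" "\<forall>x\<in>F. \<phi> x \<le> \<psi> x"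
    then show "(\<lambda>f\<in>cfuns (subtopology K F). lower_envelope F J a f - lower_envelope F J a (\<lambda>x. 0)) \<phi>
      \<le> (\<lambda>f\<in>cfuns (subtopology K F). lower_envelope F J a f - lower_envelope F J a (\<lambda>x. 0)) \<psi>"
      using mono by simp
  next
    have one: "lower_envelope F J a (const_fun (subtopology K F) 1) - lower_envelope F J a (\<lambda>x. 0) = 1"
      using shift[of "\<lambda>x. 0" 1] cong[of "const_fun (subtopology K F) 1" "\<lambda>x. 0 + 1"]
      by (simp add: const_fun_def top del: topspace_subtopology)
    then show "(\<lambda>f\<in>cfuns (subtopology K F). lower_envelope F J a f - lower_envelope F J a (\<lambda>x. 0))
      (const_fun (subtopology K F) 1) = 1"
      by (simp add: const_fun_in_cfuns)
    fix \<phi> c assume \<phi>: "\<phi> \<in> cfuns (subtopology K F)"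
    have "lower_envelope F J a (\<lambda>x\<in>F. \<phi> x + const_fun (subtopology K F) c x) = lower_envelope F J a \<phi> + c"
      unfolding shift[symmetric] by (rule cong) (use FK in \<open>auto simp: const_fun_def\<close>)
    then show "(\<lambda>f\<in>cfuns (subtopology K F). lower_envelope F J a f - lower_envelope F J a (\<lambda>x. 0))
        (\<lambda>x\<in>F. \<phi> x + const_fun (subtopology K F) c x) =
      (\<lambda>f\<in>cfuns (subtopology K F). lower_envelope F J a f - lower_envelope F J a (\<lambda>x. 0)) \<phi> +
      c * (\<lambda>f\<in>cfuns (subtopology K F). lower_envelope F J a f - lower_envelope F J a (\<lambda>x. 0))
        (const_fun (subtopology K F) 1)"
      using \<phi> one cfuns_add_const[OF \<phi>, of c] unfolding top by (simp add: const_fun_in_cfuns)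
  qed simp
qed

text \<open>The envelope of the values of \<open>\<mu>\<close> on \<open>J\<close> dominates these values on every \<open>F\<close>. It exceeds
  \<open>\<mu> \<psi>\<close> by \<open>\<delta>\<close> only if some \<open>\<phi> \<in> J\<close> satisfies \<open>\<phi> - \<psi> \<le> \<mu> \<phi> - \<mu> \<psi> - \<delta>\<close> throughout \<open>F\<close>, and this is
  ruled out by putting a witness of each gap into \<open>F\<close>.\<close>

lemma finitely_supported_approx:
  assumes \<mu>: "\<mu> \<in> O_functionals K"
    and dense: "K closure_of T = topspace K" and T: "T \<subseteq> topspace K"
    and J: "finite J" "J \<subseteq> cfuns K" and "\<delta> > 0"
  obtains \<nu> where "\<nu> \<in> finitely_supported K T" "\<And>\<phi>. \<phi> \<in> J \<Longrightarrow> \<bar>\<nu> \<phi> - \<mu> \<phi>\<bar> < \<delta>"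
proof -
  \<comment> \<open>Adjoining the zero function makes the normalizing constant small as well.\<close>
  define J0 where "J0 = insert (const_fun K 0) J"
  have J0: "finite J0" "J0 \<noteq> {}" "J0 \<subseteq> cfuns K" "const_fun K 0 \<in> J0"
    using J by (auto simp: J0_def const_fun_in_cfuns)
  have "\<exists>x\<in>T. \<mu> \<phi> - \<mu> \<psi> - \<delta> / 2 < \<phi> x - \<psi> x" if "\<phi> \<in> J0" "\<psi> \<in> J0" for \<phi> \<psi>
    using O_functionals_gap_witness[OF \<mu> _ _ dense T, of \<phi> \<psi> "\<delta> / 2"] that J0(3) \<open>\<delta> > 0\<close> by auto
  then obtain w where w: "\<And>\<phi> \<psi>. \<phi> \<in> J0 \<Longrightarrow> \<psi> \<in> J0 \<Longrightarrow>
      w \<phi> \<psi> \<in> T \<and> \<mu> \<phi> - \<mu> \<psi> - \<delta> / 2 < \<phi> (w \<phi> \<psi>) - \<psi> (w \<phi> \<psi>)"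
    by metis
  define F where "F = (\<lambda>(\<phi>, \<psi>). w \<phi> \<psi>) ` (J0 \<times> J0)"
  have F: "finite F" "F \<noteq> {}" "F \<subseteq> T" using J0 w by (auto simp: F_def)
  then have FK: "F \<subseteq> topspace K" using T by auto
  have wF: "w \<phi> \<psi> \<in> F" if "\<phi> \<in> J0" "\<psi> \<in> J0" for \<phi> \<psi>
    using that by (auto simp: F_def)
  let ?e = "lower_envelope F J0 \<mu>"
  note le_iff = le_lower_envelope_iff[OF F(1,2) J0(1,2)]
  have near: "\<mu> \<psi> \<le> ?e \<psi> \<and> ?e \<psi> < \<mu> \<psi> + \<delta> / 2" if \<psi>: "\<psi> \<in> J0" for \<psi>
  proof
    show "\<mu> \<psi> \<le> ?e \<psi>"
      unfolding le_iff using \<psi> by (intro bexI[of _ \<psi>]) auto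
    show "?e \<psi> < \<mu> \<psi> + \<delta> / 2"
    proof (rule ccontr)
      assume "\<not> ?e \<psi> < \<mu> \<psi> + \<delta> / 2"
      then obtain \<phi> where "\<phi> \<in> J0" "\<And>x. x \<in> F \<Longrightarrow> \<mu> \<psi> + \<delta> / 2 \<le> \<mu> \<phi> + (\<psi> x - \<phi> x)"
        unfolding not_less le_iff by auto
      then show False using w[of \<phi> \<psi>] wF[of \<phi> \<psi>] \<psi> by fastforce
    qed
  qed
  have cong: "?e f = ?e g" if "\<And>x. x \<in> F \<Longrightarrow> f x = g x" for f g
    unfolding lower_envelope_def using that by (simp cong: image_cong_simp)
  have const_apply: "const_fun K 0 x = 0" if "x \<in> topspace K" for x
    using that by (simp add: const_fun_def)
  have zero: "0 \<le> ?e (\<lambda>x. 0)" "?e (\<lambda>x. 0) < \<delta> / 2"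
    using near[OF J0(4)] cong[of "const_fun K 0" "\<lambda>x. 0"] FK
    by (auto simp: O_functionals_const[OF \<mu>] subset_iff const_apply)
  define \<nu>' where "\<nu>' = (\<lambda>f\<in>cfuns (subtopology K F). ?e f - ?e (\<lambda>x. 0))"
  define \<nu> where "\<nu> = (\<lambda>\<phi>\<in>cfuns K. \<nu>' (restrict \<phi> F))"
  have "\<nu>' \<in> O_functionals (subtopology K F)"
    unfolding \<nu>'_def by (rule lower_envelope_O_functional[OF F(1,2) FK J0(1,2)])
  then have "\<nu> \<in> finitely_supported K T"
    unfolding finitely_supported_def supported_on_def \<nu>_def using F by blast
  moreover have "\<bar>\<nu> \<phi> - \<mu> \<phi>\<bar> < \<delta>" if "\<phi> \<in> J" for \<phi>
  proof -
    have \<phi>: "\<phi> \<in> cfuns K" "\<phi> \<in> J0" using that J by (auto simp: J0_def)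
    have "\<nu> \<phi> = ?e \<phi> - ?e (\<lambda>x. 0)"
      using \<phi>(1) restrict_in_cfuns[OF \<phi>(1) FK] cong[of "restrict \<phi> F" \<phi>]
      by (simp add: \<nu>_def \<nu>'_def)
    then show ?thesis using near[OF \<phi>(2)] zero by linarith
  qed
  ultimately show ?thesis using that by blast
qed

lemma finitely_supported_dense:
  assumes dense: "K closure_of T = topspace K" and T: "T \<subseteq> topspace K"
    and V: "openin (pointwise_topology K (O_functionals K)) V" "V \<noteq> {}"
  shows "V \<inter> finitely_supported K T \<noteq> {}"
proof -
  obtain W where W: "openin (product_topology (\<lambda>\<phi>. euclideanreal) (cfuns K)) W"
    and VW: "V = W \<inter> O_functionals K"
    using V(1) by (auto simp: pointwise_topology_def openin_subtopology)
  obtain \<mu> where \<mu>: "\<mu> \<in> W" "\<mu> \<in> O_functionals K" using V(2) VW by auto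
  obtain U where U: "finite {\<phi> \<in> cfuns K. U \<phi> \<noteq> UNIV}" "\<And>\<phi>. \<phi> \<in> cfuns K \<Longrightarrow> open (U \<phi>)"
    "\<mu> \<in> Pi\<^sub>E (cfuns K) U" "Pi\<^sub>E (cfuns K) U \<subseteq> W"
    using W \<mu>(1) unfolding openin_product_topology_alt by auto
  define J where "J = {\<phi> \<in> cfuns K. U \<phi> \<noteq> UNIV}"
  have J: "finite J" "J \<subseteq> cfuns K" using U(1) by (auto simp: J_def)
  have "\<exists>e>0. ball (\<mu> \<phi>) e \<subseteq> U \<phi>" if "\<phi> \<in> J" for \<phi>
    using U(2)[of \<phi>] U(3) that J(2) by (auto simp: PiE_iff open_contains_ball)
  then obtain e where e: "\<And>\<phi>. \<phi> \<in> J \<Longrightarrow> e \<phi> > 0 \<and> ball (\<mu> \<phi>) (e \<phi>) \<subseteq> U \<phi>"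
    by metis
  define \<delta> where "\<delta> = Min (insert 1 (e ` J))"
  have \<delta>: "\<delta> > 0" "\<And>\<phi>. \<phi> \<in> J \<Longrightarrow> \<delta> \<le> e \<phi>" using J e by (auto simp: \<delta>_def)
  obtain \<nu> where \<nu>: "\<nu> \<in> finitely_supported K T" "\<And>\<phi>. \<phi> \<in> J \<Longrightarrow> \<bar>\<nu> \<phi> - \<mu> \<phi>\<bar> < \<delta>"
    using finitely_supported_approx[OF \<mu>(2) dense T J \<delta>(1)] by blast
  have \<nu>O: "\<nu> \<in> O_functionals K"
    using finitely_supported_in_O_functionals[OF T] \<nu>(1) by blast
  have "\<nu> \<phi> \<in> U \<phi>" if "\<phi> \<in> cfuns K" for \<phi>
  proof (cases "\<phi> \<in> J")
    case True
    then have "\<nu> \<phi> \<in> ball (\<mu> \<phi>) (e \<phi>)"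
      using \<nu>(2) \<delta>(2) by (force simp: dist_real_def abs_minus_commute)
    then show ?thesis using e[OF True] by blast
  next
    case False
    then show ?thesis using that by (simp add: J_def)
  qed
  then have "\<nu> \<in> Pi\<^sub>E (cfuns K) U"
    using \<nu>O by (auto simp: PiE_def O_functionals_def)
  then show ?thesis using U(4) VW \<nu>O \<nu>(1) by blast
qed

section \<open>Equality of the weak densities\<close>

lemma wd_pointwise_between:
  assumes "K closure_of T = topspace K" "T \<subseteq> topspace K"
    and "finitely_supported K T \<subseteq> S" "S \<subseteq> O_functionals K"
  shows "wd (pointwise_topology K S) =o wd (pointwise_topology K (O_functionals K))"
proof -
  have "pointwise_topology K S = subtopology (pointwise_topology K (O_functionals K)) S"
    using assms(4) by (simp add: pointwise_topology_def subtopology_subtopology inf_absorb2)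
  moreover have "wd (subtopology (pointwise_topology K (O_functionals K)) S) =o
      wd (pointwise_topology K (O_functionals K))"
    using assms finitely_supported_dense[OF assms(1,2)]
    by (intro wd_dense_subspace) (auto simp: topspace_pointwise_topology, blast)
  ultimately show ?thesis by simp
qed

theorem proposition5:
  fixes X :: "'a topology"
  assumes "completely_regular_space X" and "Hausdorff_space X"
  shows "wd (pointwise_topology (Stone_Cech X) (O_omega X)) =o
           wd (pointwise_topology (Stone_Cech X) (O_beta X)) \<and>
         wd (pointwise_topology (Stone_Cech X) (O_beta X)) =o
           wd (pointwise_topology (Stone_Cech X) (O_radon X)) \<and>
         wd (pointwise_topology (Stone_Cech X) (O_radon X)) =o
           wd (pointwise_topology (Stone_Cech X) (O_tau X)) \<and>
         wd (pointwise_topology (Stone_Cech X) (O_tau X)) =o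
           wd (pointwise_topology (Stone_Cech X) (O_functionals (Stone_Cech X)))"
proof -
  let ?K = "Stone_Cech X" and ?T = "sc_embed X ` topspace X"
  let ?D = "finitely_supported ?K ?T"
  have T: "?T \<subseteq> topspace ?K"
    using sc_embed_in_cube[of _ X] closure_of_subset[of ?T "unit_cube X"]
    by (auto simp: Stone_Cech_def)
  have D: "?D \<subseteq> O_functionals ?K" by (rule finitely_supported_in_O_functionals[OF T])
  have cf: "eventually (\<lambda>\<alpha>. \<phi> \<alpha> \<in> cfuns ?K) (along I r)"
    if I: "directed_on I r" and \<phi>: "\<phi> ` I \<subseteq> cfuns ?K" for I :: "'i set" and r \<phi>
  proof -
    obtain \<alpha> where "\<alpha> \<in> I" using I by (auto simp: directed_on_def)
    then show ?thesis using \<phi> unfolding eventually_along[OF I] by blast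
  qed
  have omega: "?D \<subseteq> O_omega X" and beta: "?D \<subseteq> O_beta X"
    using D support_finitely_supported[OF _ Hausdorff_Stone_Cech T]
    by (auto simp: O_omega_def O_beta_def)
  have tendsto: "((\<lambda>\<alpha>. \<mu> (\<phi> \<alpha>)) \<longlongrightarrow> 0) (along I r)"
    if "\<mu> \<in> ?D" "directed_on I r" "\<phi> ` I \<subseteq> cfuns ?K"
      "\<And>x. x \<in> topspace X \<Longrightarrow> ((\<lambda>\<alpha>. \<phi> \<alpha> (sc_embed X x)) \<longlongrightarrow> 0) (along I r)"
    for \<mu> \<phi> and I :: "'i set" and r
    using that by (intro finitely_supported_tendsto[OF that(1) T cf]) auto
  have tau: "?D \<subseteq> O_tau X"
  proof
    fix \<mu> assume \<mu>: "\<mu> \<in> ?D"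
    have "((\<lambda>\<alpha>. \<mu> (\<phi> \<alpha>)) \<longlongrightarrow> 0) (along I r)"
      if "directed_on I r \<and> \<phi> ` I \<subseteq> cfuns ?K \<and> decreasing_to_zero_on X I r \<phi>"
      for I :: "('a sc_fun \<times> 'a sc_fun set) set" and r \<phi>
      by (rule tendsto[OF \<mu>]) (use that in \<open>simp_all add: decreasing_to_zero_on_def\<close>)
    then show "\<mu> \<in> O_tau X" using D \<mu> unfolding O_tau_def by blast
  qed
  have point: "((\<lambda>\<alpha>. \<phi> \<alpha> (sc_embed X x)) \<longlongrightarrow> 0) (along I r)"
    if "bounded_zero_on_compacts X I r \<phi>" "x \<in> topspace X" for I :: "'i set" and r \<phi> x
  proof -
    have "compactin X {x}" using that(2) by simp
    then have "uniform_limit {x} (\<lambda>\<alpha> x. \<phi> \<alpha> (sc_embed X x)) (\<lambda>x. 0) (along I r)"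
      using that(1) unfolding bounded_zero_on_compacts_def by blast
    then show ?thesis by (rule tendsto_uniform_limitI) simp
  qed
  have radon: "?D \<subseteq> O_radon X"
  proof
    fix \<mu> assume \<mu>: "\<mu> \<in> ?D"
    have "((\<lambda>\<alpha>. \<mu> (\<phi> \<alpha>)) \<longlongrightarrow> 0) (along I r)"
      if "directed_on I r \<and> \<phi> ` I \<subseteq> cfuns ?K \<and> bounded_zero_on_compacts X I r \<phi>"
      for I :: "('a sc_fun \<times> 'a sc_fun set) set" and r \<phi>
      by (rule tendsto[OF \<mu>]) (use that point in blast)+
    then show "\<mu> \<in> O_radon X" using D \<mu> unfolding O_radon_def by blast
  qed
  note eq = wd_pointwise_between[OF dense_Stone_Cech T]
  have "O_omega X \<subseteq> O_functionals ?K" "O_beta X \<subseteq> O_functionals ?K"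
    "O_radon X \<subseteq> O_functionals ?K" "O_tau X \<subseteq> O_functionals ?K"
    by (auto simp: O_omega_def O_beta_def O_radon_def O_tau_def)
  then show ?thesis
    using eq[OF omega] eq[OF beta] eq[OF radon] eq[OF tau]
    by (meson ordIso_transitive ordIso_symmetric)
qed

end
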